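(* Let $H_1,\dots,H_r$ be groups with a normalized $r$-total system $S^{(r)}$, let $G=H_1\times\cdots\times H_r$ carry the associated multiplication $\mu$, written $x\cdot y$, let $G'$ be a set with an associative multiplication, let $f_i:H_i\to G'$ ($1\le i\le r$) be maps, and let $f:G\to G'$ be the map assembled from them by $f(h_1,\dots,h_r)=f_1(h_1)\cdots f_r(h_r)$, where $f$ is assumed to satisfy $f(h_i)=f_i(h_i)$ for each $i$ and each $h_i\in H_i$ (regarded as an element of $G$). Suppose that for all $j,k$ with $r\ge k\ge j\ge1$ and all $a_k\in H_k$, $b_j\in H_j$ one has $$f(a_k\cdot b_j)=f(a_k)\cdot f(b_j).$$ Then $f$ is a homomorphism on $G$, i.e. $f(u\cdot v)=f(u)\cdot f(v)$ for all $u,v\in G$.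
   Context: Let $r\ge1$ and let $H_1,\dots,H_r$ be groups. An $r$-total system $S^{(r)}$ consists of maps $\phi_k^j:H_k\to \mathrm{Maps}(H_j,H_j)$ for all $r\ge k>j\ge1$ (where $\mathrm{Maps}(H_j,H_j)$ is the set of all set-theoretic self-maps of $H_j$; the value of $\phi_k^j(h_k)$ at $h_j$ is written ${}^{\phi_k^j(h_k)}h_j$) and maps (brackets) $[\cdot,\cdot]_{kj}^i:H_k\times H_j\to H_i$ for all $r\ge k>j>i\ge1$. It is normalized if: $\phi_j^i(1)=\mathrm{id}_{H_i}$ and ${}^{\phi_j^i(h_j)}1=1$ for all $r\ge j>i\ge1$, $h_j\in H_j$; and $[1,h_j]_{kj}^i=1$, $[h_k,1]_{kj}^i=1$ for all $r\ge k>j>i\ge1$, $h_j\in H_j$, $h_k\in H_k$. Let $G$ be the set $H_1\times\cdots\times H_r$. For $0\le k\le r$ let $R_k\subseteq G$ be the set of tuples $(h_1,\dots,h_k,1,\dots,1)$. An element $h_i\in H_i$ is identified with the tuple in $G$ having $h_i$ in position $i$ and $1$ elsewhere. For $k>j$, $h_k\in H_k$, $h_j\in H_j$ put $$\phi_{h_k}(h_j)=\big([h_k,h_j]_{kj}^1,\dots,[h_k,h_j]_{kj}^{j-1},{}^{\phi_k^j(h_k)}h_j,1,\dots,1\big)\in R_j.$$ Multiplications $\mu_k:R_k\times R_k\to R_k$ are defined recursively. $\mu_1$ is the group law of $H_1$. Given $\mu_k$, write $\mu_k(w_1)=w_1$ and $\mu_k(w_1,\dots,w_m)=\mu_k(\mu_k(w_1,\dots,w_{m-1}),w_m)$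 for $w_1,\dots,w_m\in R_k$; then for $a=(a_1,\dots,a_{k+1},1,\dots,1)$ and $b=(b_1,\dots,b_{k+1},1,\dots,1)$, $\mu_{k+1}(a,b)$ is the tuple whose first $k$ entries are those of $$\mu_k\big((a_1,\dots,a_k,1,\dots,1),\ \mu_k(\phi_{a_{k+1}}(b_1),\dots,\phi_{a_{k+1}}(b_k))\big),$$ whose $(k+1)$st entry is $a_{k+1}b_{k+1}$, and whose other entries are $1$. Put $\mu=\mu_r:G\times G\to G$, $x\cdot y=\mu(x,y)$. The multiplication $\mu$ is not assumed associative. The dot also denotes the multiplication of $G'$. The assumption $f(h_i)=f_i(h_i)$ means explicitly $f_1(1)\cdots f_{i-1}(1)f_i(h_i)f_{i+1}(1)\cdots f_r(1)=f_i(h_i)$ for all $i$ and $h_i\in H_i$ (this is automatic if $G'$ is a monoid and each $f_i(1)$ is its unit). *)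

theory Defs
  imports "HOL-Algebra.Group" "HOL-Library.FuncSet"
begin

text \<open>
  The groups \<open>H 1, \<dots>, H r\<close> are a family indexed by \<open>nat\<close> whose carriers live in a common
  type; only the indices \<open>1, \<dots>, r\<close> matter.  Tuples are extensional functions on \<open>{1..r}\<close>.
  Below, \<open>\<phi> k j h x\<close> is the value of \<open>\<phi>\<^sub>k\<^sup>j(h)\<close> at \<open>x\<close>, and
  \<open>br k j i h x\<close> is the bracket of \<open>h \<in> H k\<close> and \<open>x \<in> H j\<close> with values in \<open>H i\<close>.
\<close>

definition tuples :: "nat \<Rightarrow> (nat \<Rightarrow> ('a, 'm) monoid_scheme) \<Rightarrow> (nat \<Rightarrow> 'a) set" where
  "tuples r H = (\<Pi>\<^sub>E i\<in>{1..r}. carrier (H i))"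

definition embed :: "nat \<Rightarrow> (nat \<Rightarrow> ('a, 'm) monoid_scheme) \<Rightarrow> nat \<Rightarrow> 'a \<Rightarrow> nat \<Rightarrow> 'a" where
  "embed r H i h = (\<lambda>l\<in>{1..r}. if l = i then h else \<one>\<^bsub>H l\<^esub>)"

definition total_system ::
  "nat \<Rightarrow> (nat \<Rightarrow> ('a, 'm) monoid_scheme) \<Rightarrow> (nat \<Rightarrow> nat \<Rightarrow> 'a \<Rightarrow> 'a \<Rightarrow> 'a) \<Rightarrow>
    (nat \<Rightarrow> nat \<Rightarrow> nat \<Rightarrow> 'a \<Rightarrow> 'a \<Rightarrow> 'a) \<Rightarrow> bool" where
  "total_system r H \<phi> br \<longleftrightarrow>
     (\<forall>k j. 1 \<le> j \<and> j < k \<and> k \<le> r \<longrightarrow>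
        \<phi> k j \<in> carrier (H k) \<rightarrow> carrier (H j) \<rightarrow> carrier (H j)) \<and>
     (\<forall>k j i. 1 \<le> i \<and> i < j \<and> j < k \<and> k \<le> r \<longrightarrow>
        br k j i \<in> carrier (H k) \<rightarrow> carrier (H j) \<rightarrow> carrier (H i))"

definition normalized ::
  "nat \<Rightarrow> (nat \<Rightarrow> ('a, 'm) monoid_scheme) \<Rightarrow> (nat \<Rightarrow> nat \<Rightarrow> 'a \<Rightarrow> 'a \<Rightarrow> 'a) \<Rightarrow>
    (nat \<Rightarrow> nat \<Rightarrow> nat \<Rightarrow> 'a \<Rightarrow> 'a \<Rightarrow> 'a) \<Rightarrow> bool" where
  "normalized r H \<phi> br \<longleftrightarrow>
     (\<forall>j i. 1 \<le> i \<and> i < j \<and> j \<le> r \<longrightarrow>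
        (\<forall>x\<in>carrier (H i). \<phi> j i \<one>\<^bsub>H j\<^esub> x = x) \<and>
        (\<forall>h\<in>carrier (H j). \<phi> j i h \<one>\<^bsub>H i\<^esub> = \<one>\<^bsub>H i\<^esub>)) \<and>
     (\<forall>k j i. 1 \<le> i \<and> i < j \<and> j < k \<and> k \<le> r \<longrightarrow>
        (\<forall>h\<in>carrier (H j). br k j i \<one>\<^bsub>H k\<^esub> h = \<one>\<^bsub>H i\<^esub>) \<and>
        (\<forall>h\<in>carrier (H k). br k j i h \<one>\<^bsub>H j\<^esub> = \<one>\<^bsub>H i\<^esub>))"

text \<open>The tuple \<open>\<phi>\<^sub>h(x)\<close> for \<open>h \<in> H k\<close>, \<open>x \<in> H j\<close> and \<open>j < k\<close>.\<close>

definition phi_tuple ::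
  "nat \<Rightarrow> (nat \<Rightarrow> ('a, 'm) monoid_scheme) \<Rightarrow> (nat \<Rightarrow> nat \<Rightarrow> 'a \<Rightarrow> 'a \<Rightarrow> 'a) \<Rightarrow>
    (nat \<Rightarrow> nat \<Rightarrow> nat \<Rightarrow> 'a \<Rightarrow> 'a \<Rightarrow> 'a) \<Rightarrow> nat \<Rightarrow> nat \<Rightarrow> 'a \<Rightarrow> 'a \<Rightarrow> nat \<Rightarrow> 'a" where
  "phi_tuple r H \<phi> br k j h x =
     (\<lambda>i\<in>{1..r}. if i < j then br k j i h x else if i = j then \<phi> k j h x else \<one>\<^bsub>H i\<^esub>)"

text \<open>
  The left-nested product \<open>(\<dots>(w 1 w 2)\<dots>) w n\<close> for a not necessarily associative
  operation.  It is only meaningful for \<open>n \<ge> 1\<close>; the value at \<open>0\<close> is a dummy.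
\<close>

fun left_prod :: "('b \<Rightarrow> 'b \<Rightarrow> 'b) \<Rightarrow> (nat \<Rightarrow> 'b) \<Rightarrow> nat \<Rightarrow> 'b" where
  "left_prod m w 0 = undefined"
| "left_prod m w (Suc 0) = w 1"
| "left_prod m w (Suc (Suc n)) = m (left_prod m w (Suc n)) (w (Suc (Suc n)))"

definition truncate ::
  "nat \<Rightarrow> (nat \<Rightarrow> ('a, 'm) monoid_scheme) \<Rightarrow> nat \<Rightarrow> (nat \<Rightarrow> 'a) \<Rightarrow> nat \<Rightarrow> 'a" where
  "truncate r H k a = (\<lambda>i\<in>{1..r}. if i \<le> k then a i else \<one>\<^bsub>H i\<^esub>)"

text \<open>
  The multiplications \<open>\<mu>\<^sub>k\<close>, used only on tuples that are \<open>\<one>\<close> beyond position \<open>k\<close>.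
  The recursion starts at \<open>k = 1\<close>; the value at \<open>k = 0\<close> is a dummy.
\<close>

fun mu ::
  "nat \<Rightarrow> (nat \<Rightarrow> ('a, 'm) monoid_scheme) \<Rightarrow> (nat \<Rightarrow> nat \<Rightarrow> 'a \<Rightarrow> 'a \<Rightarrow> 'a) \<Rightarrow>
    (nat \<Rightarrow> nat \<Rightarrow> nat \<Rightarrow> 'a \<Rightarrow> 'a \<Rightarrow> 'a) \<Rightarrow> nat \<Rightarrow>
    (nat \<Rightarrow> 'a) \<Rightarrow> (nat \<Rightarrow> 'a) \<Rightarrow> nat \<Rightarrow> 'a" where
  "mu r H \<phi> br 0 a b = undefined"
| "mu r H \<phi> br (Suc 0) a b = embed r H 1 (a 1 \<otimes>\<^bsub>H 1\<^esub> b 1)"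
| "mu r H \<phi> br (Suc (Suc n)) a b =
     (let k = Suc n;
          c = mu r H \<phi> br k (truncate r H k a)
                (left_prod (mu r H \<phi> br k)
                  (\<lambda>j. phi_tuple r H \<phi> br (Suc k) j (a (Suc k)) (b j)) k)
      in (\<lambda>i\<in>{1..r}. if i \<le> k then c i
                     else if i = Suc k then a i \<otimes>\<^bsub>H i\<^esub> b i
                     else \<one>\<^bsub>H i\<^esub>))"

definition total_mult ::
  "nat \<Rightarrow> (nat \<Rightarrow> ('a, 'm) monoid_scheme) \<Rightarrow> (nat \<Rightarrow> nat \<Rightarrow> 'a \<Rightarrow> 'a \<Rightarrow> 'a) \<Rightarrow>
    (nat \<Rightarrow> nat \<Rightarrow> nat \<Rightarrow> 'a \<Rightarrow> 'a \<Rightarrow> 'a) \<Rightarrow>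
    (nat \<Rightarrow> 'a) \<Rightarrow> (nat \<Rightarrow> 'a) \<Rightarrow> nat \<Rightarrow> 'a" where
  "total_mult r H \<phi> br = mu r H \<phi> br r"

definition semigroup_on :: "'b set \<Rightarrow> ('b \<Rightarrow> 'b \<Rightarrow> 'b) \<Rightarrow> bool" where
  "semigroup_on S m \<longleftrightarrow>
     (\<forall>x\<in>S. \<forall>y\<in>S. m x y \<in> S) \<and>
     (\<forall>x\<in>S. \<forall>y\<in>S. \<forall>z\<in>S. m (m x y) z = m x (m y z))"

end

theory Submission
  imports Defs
begin

text \<open>
  Write \<open>R\<^sub>k\<close> for the tuples that are trivial beyond position \<open>k\<close>, and \<open>e\<close> for the common value
  of the maps \<open>f\<^sub>i\<close> at \<open>1\<close>.

  The multiplication \<open>\<mu>\<close> is not associative in general, but normalization makes it unital, makes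
  \<open>\<mu>\<^sub>l\<close> extend \<open>\<mu>\<^sub>k\<close> for \<open>k \<le> l\<close> (lemma \<open>mu_restrict\<close>), and makes every tuple the left-nested
  product of its entries.  Hence the products of two embedded elements can be computed
  inside \<open>\<mu>\<^sub>k\<close>, where they say exactly how an element of \<open>H\<^sub>k\<close> moves past one of \<open>H\<^sub>j\<close>:
  \<open>h \<cdot> x = \<phi>\<^sub>h(x) h\<close> for \<open>h \<in> H\<^sub>k\<close>, \<open>x \<in> H\<^sub>j\<close>, \<open>j < k\<close> (lemma \<open>mu_embed_below\<close>), and
  \<open>h \<cdot> x = hx\<close> for \<open>j = k\<close> (lemma \<open>mu_embed_same\<close>).

  So the hypothesis on pairs of embedded elements amounts to two rules in \<open>G'\<close>:
  \<open>f(\<phi>\<^sub>h(x)) f\<^sub>k(h) = f\<^sub>k(h) f\<^sub>j(x)\<close> for \<open>j < k\<close>, and \<open>f\<^sub>k(h) f\<^sub>k(x) = f\<^sub>k(hx)\<close>.  The case \<open>x = 1\<close>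
  of the second rule is \<open>f\<^sub>k(h) e = f\<^sub>k(h)\<close>, so that \<open>f\<close> on \<open>R\<^sub>k\<close> is the product of only the first
  \<open>k\<close> values (lemma \<open>f_on_R\<close>).

  Multiplicativity on \<open>R\<^sub>k\<close> now follows by induction on \<open>k\<close>.  For \<open>a = a' h\<close> and \<open>b = b' x\<close> with
  \<open>a', b' \<in> R\<^sub>k\<close> and \<open>h, x \<in> H\<^sub>k\<^sub>+\<^sub>1\<close>, the recursion and the induction hypothesis give
  \<open>f(a \<cdot> b) = f(a') f(\<phi>\<^sub>h(b\<^sub>1)) \<dots> f(\<phi>\<^sub>h(b\<^sub>k)) f\<^sub>k\<^sub>+\<^sub>1(hx)\<close>.
  Split the last factor by the second rule, and move \<open>f\<^sub>k\<^sub>+\<^sub>1(h)\<close> to the left through the factors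
  \<open>f(\<phi>\<^sub>h(b\<^sub>j))\<close> by the first; what remains is \<open>f(a') f\<^sub>k\<^sub>+\<^sub>1(h) f(b') f\<^sub>k\<^sub>+\<^sub>1(x) = f(a) f(b)\<close>.
\<close>

section \<open>Left-nested products\<close>

lemma left_prod_Suc: "1 \<le> n \<Longrightarrow> left_prod m w (Suc n) = m (left_prod m w n) (w (Suc n))"
  by (cases n) auto

lemma left_prod_cong:
  assumes "1 \<le> n" "\<And>i. 1 \<le> i \<Longrightarrow> i \<le> n \<Longrightarrow> w i = w' i"
  shows "left_prod m w n = left_prod m w' n"
  using assms by (induction n rule: nat_induct_at_least) (auto simp: left_prod_Suc)

lemma left_prod_closed:
  assumes "1 \<le> n" "\<And>x y. x \<in> S \<Longrightarrow> y \<in> S \<Longrightarrow> m x y \<in> S" "\<And>i. 1 \<le> i \<Longrightarrow> i \<le> n \<Longrightarrow> w i \<in> S"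
  shows "left_prod m w n \<in> S"
  using assms by (induction n rule: nat_induct_at_least) (auto simp: left_prod_Suc)

lemma left_prod_hom:
  assumes "1 \<le> n"
    and "\<And>x y. x \<in> S \<Longrightarrow> y \<in> S \<Longrightarrow> m x y \<in> S"
    and "\<And>x y. x \<in> S \<Longrightarrow> y \<in> S \<Longrightarrow> g (m x y) = m' (g x) (g y)"
    and "\<And>i. 1 \<le> i \<Longrightarrow> i \<le> n \<Longrightarrow> w i \<in> S"
  shows "g (left_prod m w n) = left_prod m' (\<lambda>i. g (w i)) n"
  using assms
proof (induction n rule: nat_induct_at_least)
  case (Suc n)
  have "left_prod m w n \<in> S"
    using Suc.hyps Suc.prems by (intro left_prod_closed) auto
  then show ?case
    using Suc by (auto simp: left_prod_Suc)
qed simp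

lemma left_prod_single:
  assumes "1 \<le> n" "1 \<le> j" "m e e = e" "m e y = y" "m y e = y"
  shows "left_prod m (\<lambda>i. if i = j then y else e) n = (if j \<le> n then y else e)"
  using assms by (induction n rule: nat_induct_at_least) (auto simp: left_prod_Suc)

text \<open>
  Associativity lets \<open>z\<close> pass the factors one at a time, from the last to the first; each turns
  from \<open>p i\<close> into \<open>q i\<close> as \<open>z\<close> passes it.
\<close>

lemma left_prod_commute:
  assumes "semigroup_on S m" "1 \<le> n" "z \<in> S"
    and "\<And>i. 1 \<le> i \<Longrightarrow> i \<le> n \<Longrightarrow> p i \<in> S" "\<And>i. 1 \<le> i \<Longrightarrow> i \<le> n \<Longrightarrow> q i \<in> S"
    and "\<And>i. 1 \<le> i \<Longrightarrow> i \<le> n \<Longrightarrow> m (p i) z = m z (q i)"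
  shows "m (left_prod m p n) z = m z (left_prod m q n)"
  using assms(2,4-)
proof (induction n rule: nat_induct_at_least)
  case (Suc n)
  have mc: "\<And>x y. x \<in> S \<Longrightarrow> y \<in> S \<Longrightarrow> m x y \<in> S"
    and ma: "\<And>x y z. x \<in> S \<Longrightarrow> y \<in> S \<Longrightarrow> z \<in> S \<Longrightarrow> m (m x y) z = m x (m y z)"
    using assms(1) by (auto simp: semigroup_on_def)
  have P: "left_prod m p n \<in> S" and Q: "left_prod m q n \<in> S"
    using Suc.hyps Suc.prems by (auto intro!: left_prod_closed mc)
  have p: "p (Suc n) \<in> S" and q: "q (Suc n) \<in> S"
    and s: "m (p (Suc n)) z = m z (q (Suc n))"
    using Suc.prems by auto
  have "m (left_prod m p (Suc n)) z = m (left_prod m p n) (m (p (Suc n)) z)"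
    using Suc.hyps P p \<open>z \<in> S\<close> by (simp add: left_prod_Suc ma)
  also have "\<dots> = m (m (left_prod m p n) z) (q (Suc n))"
    using P q \<open>z \<in> S\<close> by (simp add: s ma)
  also have "\<dots> = m (m z (left_prod m q n)) (q (Suc n))"
    using Suc.IH Suc.prems by simp
  also have "\<dots> = m z (left_prod m q (Suc n))"
    using Suc.hyps Q q \<open>z \<in> S\<close> by (simp add: left_prod_Suc ma)
  finally show ?case .
qed simp

section \<open>The multiplications of a normalized total system\<close>

locale normalized_total_system =
  fixes r :: nat
    and H :: "nat \<Rightarrow> ('a, 'm) monoid_scheme"
    and \<phi> :: "nat \<Rightarrow> nat \<Rightarrow> 'a \<Rightarrow> 'a \<Rightarrow> 'a"
    and br :: "nat \<Rightarrow> nat \<Rightarrow> nat \<Rightarrow> 'a \<Rightarrow> 'a \<Rightarrow> 'a"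
  assumes grp: "\<And>i. 1 \<le> i \<Longrightarrow> i \<le> r \<Longrightarrow> group (H i)"
    and total: "total_system r H \<phi> br"
    and norm: "normalized r H \<phi> br"
begin

abbreviation "\<mu> \<equiv> mu r H \<phi> br"

definition trivial :: "nat \<Rightarrow> 'a" where
  "trivial = (\<lambda>l\<in>{1..r}. \<one>\<^bsub>H l\<^esub>)"

definition R :: "nat \<Rightarrow> (nat \<Rightarrow> 'a) set" where
  "R k = {a \<in> tuples r H. \<forall>i\<in>{1..r}. k < i \<longrightarrow> a i = \<one>\<^bsub>H i\<^esub>}"

definition put_top :: "nat \<Rightarrow> (nat \<Rightarrow> 'a) \<Rightarrow> 'a \<Rightarrow> nat \<Rightarrow> 'a" where
  "put_top k c x = (\<lambda>i\<in>{1..r}. if i \<le> k then c i else if i = Suc k then x else \<one>\<^bsub>H i\<^esub>)"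

text \<open>
  The factor \<open>\<mu>\<^sub>k(\<phi>\<^sub>h(b\<^sub>1), \<dots>, \<phi>\<^sub>h(b\<^sub>k))\<close> with \<open>h \<in> H\<^sub>k\<^sub>+\<^sub>1\<close> in the recursion for \<open>\<mu>\<^sub>k\<^sub>+\<^sub>1\<close>.
\<close>

definition act :: "nat \<Rightarrow> 'a \<Rightarrow> (nat \<Rightarrow> 'a) \<Rightarrow> nat \<Rightarrow> 'a" where
  "act k h b = left_prod (\<mu> k) (\<lambda>j. phi_tuple r H \<phi> br (Suc k) j h (b j)) k"

lemma mu_Suc:
  assumes "1 \<le> k" "Suc k \<le> r"
  shows "\<mu> (Suc k) a b = put_top k (\<mu> k (truncate r H k a) (act k (a (Suc k)) b))
    (a (Suc k) \<otimes>\<^bsub>H (Suc k)\<^esub> b (Suc k))"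
  using assms by (cases k) (auto simp: put_top_def act_def Let_def intro!: restrict_ext)

lemma one_closed: "1 \<le> i \<Longrightarrow> i \<le> r \<Longrightarrow> \<one>\<^bsub>H i\<^esub> \<in> carrier (H i)"
  using grp by (simp add: group.is_monoid)

lemma mult_closed:
  "1 \<le> i \<Longrightarrow> i \<le> r \<Longrightarrow> x \<in> carrier (H i) \<Longrightarrow> y \<in> carrier (H i) \<Longrightarrow> x \<otimes>\<^bsub>H i\<^esub> y \<in> carrier (H i)"
  using grp by (simp add: group.is_monoid monoid.m_closed)

lemma mult_one [simp]:
  "1 \<le> i \<Longrightarrow> i \<le> r \<Longrightarrow> x \<in> carrier (H i) \<Longrightarrow> x \<otimes>\<^bsub>H i\<^esub> \<one>\<^bsub>H i\<^esub> = x"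
  "1 \<le> i \<Longrightarrow> i \<le> r \<Longrightarrow> x \<in> carrier (H i) \<Longrightarrow> \<one>\<^bsub>H i\<^esub> \<otimes>\<^bsub>H i\<^esub> x = x"
  using grp by (simp_all add: group.is_monoid)

lemma entry_closed: "a \<in> R k \<Longrightarrow> 1 \<le> i \<Longrightarrow> i \<le> r \<Longrightarrow> a i \<in> carrier (H i)"
  by (auto simp: R_def tuples_def PiE_def)

lemma entry_beyond: "a \<in> R k \<Longrightarrow> k < i \<Longrightarrow> i \<le> r \<Longrightarrow> a i = \<one>\<^bsub>H i\<^esub>"
  by (auto simp: R_def)

lemma R_I:
  assumes "a \<in> extensional {1..r}" "\<And>i. 1 \<le> i \<Longrightarrow> i \<le> r \<Longrightarrow> a i \<in> carrier (H i)"
    "\<And>i. 1 \<le> i \<Longrightarrow> i \<le> r \<Longrightarrow> k < i \<Longrightarrow> a i = \<one>\<^bsub>H i\<^esub>"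
  shows "a \<in> R k"
  using assms by (auto simp: R_def tuples_def PiE_def)

lemma R_extensional: "a \<in> R k \<Longrightarrow> a \<in> extensional {1..r}"
  by (auto simp: R_def tuples_def PiE_def)

lemma R_mono: "a \<in> R k \<Longrightarrow> k \<le> l \<Longrightarrow> a \<in> R l"
  by (auto simp: R_def)

lemma R_top: "R r = tuples r H"
  by (auto simp: R_def)

lemma trivial_in_R: "trivial \<in> R k"
  by (rule R_I) (auto simp: trivial_def one_closed)

lemma embed_in_R: "j \<le> k \<Longrightarrow> x \<in> carrier (H j) \<Longrightarrow> embed r H j x \<in> R k"
  by (rule R_I) (auto simp: embed_def one_closed)

lemma truncate_in_R: "a \<in> R l \<Longrightarrow> truncate r H k a \<in> R k"
  by (rule R_I) (auto simp: truncate_def one_closed entry_closed)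

lemma put_top_in_R:
  "c \<in> R l \<Longrightarrow> x \<in> carrier (H (Suc k)) \<Longrightarrow> put_top k c x \<in> R (Suc k)"
  by (rule R_I) (auto simp: put_top_def one_closed entry_closed)

lemma phi_tuple_in_R:
  assumes "1 \<le> j" "j < k" "k \<le> r" "h \<in> carrier (H k)" "x \<in> carrier (H j)" "j \<le> l"
  shows "phi_tuple r H \<phi> br k j h x \<in> R l"
proof (rule R_I)
  fix i assume i: "1 \<le> i" "i \<le> r"
  have "\<phi> k j \<in> carrier (H k) \<rightarrow> carrier (H j) \<rightarrow> carrier (H j)"
    using total assms unfolding total_system_def by blast
  then have "\<phi> k j h x \<in> carrier (H j)"
    using assms by blast
  moreover have "br k j i h x \<in> carrier (H i)" if "i < j"
  proof -
    have "br k j i \<in> carrier (H k) \<rightarrow> carrier (H j) \<rightarrow> carrier (H i)"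
      using total assms i that unfolding total_system_def by blast
    then show ?thesis
      using assms by blast
  qed
  ultimately show "phi_tuple r H \<phi> br k j h x i \<in> carrier (H i)"
    using i by (auto simp: phi_tuple_def one_closed)
qed (use assms in \<open>auto simp: phi_tuple_def\<close>)

lemma R_eqI:
  assumes "a \<in> R k" "b \<in> R l" "\<And>i. 1 \<le> i \<Longrightarrow> i \<le> r \<Longrightarrow> a i = b i"
  shows "a = b"
  using assms by (intro extensionalityI[of a "{1..r}"]) (auto dest: R_extensional)

lemma truncate_id: "a \<in> R k \<Longrightarrow> truncate r H k a = a"
  by (rule R_eqI[of _ k _ k]) (auto simp: truncate_in_R, auto simp: truncate_def entry_beyond)

lemma put_top_one: "c \<in> R k \<Longrightarrow> put_top k c \<one>\<^bsub>H (Suc k)\<^esub> = c"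
  by (rule extensionalityI[of _ "{1..r}"])
    (simp add: put_top_def, erule R_extensional, auto simp: put_top_def entry_beyond)

lemma put_top_truncate: "a \<in> R (Suc k) \<Longrightarrow> put_top k (truncate r H k a) (a (Suc k)) = a"
  by (rule extensionalityI[of _ "{1..r}"])
    (simp add: put_top_def, erule R_extensional,
      auto simp: put_top_def truncate_def entry_beyond le_Suc_eq)

lemma truncate_Suc:
  "put_top k (truncate r H k a) (a (Suc k)) = truncate r H (Suc k) a"
  by (auto simp: put_top_def truncate_def fun_eq_iff le_Suc_eq)

lemma embed_one: "embed r H i \<one>\<^bsub>H i\<^esub> = trivial"
  by (auto simp: embed_def trivial_def intro!: restrict_ext)

lemma embed_Suc: "embed r H (Suc k) x = put_top k trivial x"
  by (auto simp: embed_def put_top_def trivial_def fun_eq_iff)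

text \<open>The four conditions of normalization, as two identities of tuples.\<close>

lemma phi_tuple_one_left:
  assumes "1 \<le> j" "j < k" "k \<le> r" "x \<in> carrier (H j)"
  shows "phi_tuple r H \<phi> br k j \<one>\<^bsub>H k\<^esub> x = embed r H j x"
  using norm assms unfolding normalized_def phi_tuple_def embed_def
  by (intro restrict_ext) auto

lemma phi_tuple_one_right:
  assumes "1 \<le> j" "j < k" "k \<le> r" "h \<in> carrier (H k)"
  shows "phi_tuple r H \<phi> br k j h \<one>\<^bsub>H j\<^esub> = trivial"
  using norm assms unfolding normalized_def phi_tuple_def trivial_def
  by (intro restrict_ext) auto

lemma phi_tuple_factor_in_R:
  assumes "Suc k \<le> r" "h \<in> carrier (H (Suc k))" "b \<in> R l" "1 \<le> i" "i \<le> k"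
  shows "phi_tuple r H \<phi> br (Suc k) i h (b i) \<in> R k"
  using assms by (intro phi_tuple_in_R) (auto intro: entry_closed)

lemma mu_closed:
  assumes "1 \<le> k" "k \<le> r" "a \<in> R k" "b \<in> R k"
  shows "\<mu> k a b \<in> R k"
  using assms
proof (induction k arbitrary: a b rule: nat_induct_at_least)
  case base
  then show ?case
    by (auto simp: embed_in_R mult_closed entry_closed)
next
  case (Suc k)
  have "act k (a (Suc k)) b \<in> R k"
    unfolding act_def
    using Suc by (intro left_prod_closed phi_tuple_factor_in_R) (auto simp: entry_closed)
  then have "\<mu> k (truncate r H k a) (act k (a (Suc k)) b) \<in> R k"
    using Suc by (auto intro: truncate_in_R)
  then show ?case
    using Suc.hyps Suc.prems
    by (auto simp: mu_Suc mult_closed entry_closed intro!: put_top_in_R)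
qed

lemma act_in_R:
  assumes "1 \<le> k" "Suc k \<le> r" "h \<in> carrier (H (Suc k))" "b \<in> R l"
  shows "act k h b \<in> R k"
  unfolding act_def
  using assms by (auto intro!: left_prod_closed mu_closed phi_tuple_factor_in_R)

text \<open>
  All the factors are \<open>\<phi>\<^sub>h(1) = 1\<close>.  That their product is trivial is an instance of the right
  unit law for \<open>\<mu>\<^sub>k\<close>, which is a premise here because the unit law for \<open>\<mu>\<^sub>k\<^sub>+\<^sub>1\<close> is in turn
  derived from this lemma.
\<close>

lemma act_trivial_aux:
  assumes "1 \<le> k" "Suc k \<le> r" "h \<in> carrier (H (Suc k))"
    and b: "\<And>j. 1 \<le> j \<Longrightarrow> j \<le> k \<Longrightarrow> b j = \<one>\<^bsub>H j\<^esub>"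
    and unit: "\<mu> k trivial trivial = trivial"
  shows "act k h b = trivial"
proof -
  have "act k h b = left_prod (\<mu> k) (\<lambda>j. if j = 1 then trivial else trivial) k"
    unfolding act_def using assms
    by (intro left_prod_cong) (auto simp: phi_tuple_one_right)
  also have "\<dots> = trivial"
    using left_prod_single[of k 1 "\<mu> k" trivial trivial] \<open>1 \<le> k\<close> unit by simp
  finally show ?thesis .
qed

lemma mu_trivial_right:
  assumes "1 \<le> k" "k \<le> r" "c \<in> R k"
  shows "\<mu> k c trivial = c"
  using assms
proof (induction k arbitrary: c rule: nat_induct_at_least)
  case base
  then show ?case
    by (intro R_eqI[of _ 1 _ 1])
      (auto intro!: embed_in_R simp: trivial_def entry_closed,
       auto simp: embed_def entry_closed entry_beyond)
next
  case (Suc k)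
  have "act k (c (Suc k)) trivial = trivial"
    using Suc.hyps Suc.prems
    by (intro act_trivial_aux Suc.IH) (auto simp: entry_closed trivial_in_R, auto simp: trivial_def)
  then have "\<mu> (Suc k) c trivial
      = put_top k (truncate r H k c) (c (Suc k) \<otimes>\<^bsub>H (Suc k)\<^esub> trivial (Suc k))"
    using Suc by (simp add: mu_Suc truncate_in_R)
  also have "c (Suc k) \<otimes>\<^bsub>H (Suc k)\<^esub> trivial (Suc k) = c (Suc k)"
    using Suc.prems by (auto simp: trivial_def entry_closed)
  finally show ?case
    using Suc.prems by (simp add: put_top_truncate)
qed

lemma act_trivial:
  assumes "1 \<le> k" "Suc k \<le> r" "h \<in> carrier (H (Suc k))"
    and "\<And>j. 1 \<le> j \<Longrightarrow> j \<le> k \<Longrightarrow> b j = \<one>\<^bsub>H j\<^esub>"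
  shows "act k h b = trivial"
  using assms by (intro act_trivial_aux mu_trivial_right) (auto simp: trivial_in_R)

text \<open>
  If embedded elements can be appended one at a time, then a tuple is the product of its
  entries; these are the factors of the action of \<open>1 \<in> H\<^sub>k\<^sub>+\<^sub>1\<close>.  The premise is discharged
  by the next lemma, whose induction step needs the conclusion for smaller \<open>k\<close>.
\<close>

lemma act_one_aux:
  assumes "1 \<le> k" "Suc k \<le> r" "b \<in> R l"
    and append: "\<And>m c x. m < k \<Longrightarrow> c \<in> R m \<Longrightarrow> x \<in> carrier (H (Suc m)) \<Longrightarrow>
      \<mu> k c (embed r H (Suc m) x) = put_top m c x"
  shows "act k \<one>\<^bsub>H (Suc k)\<^esub> b = truncate r H k b"
proof -
  have "left_prod (\<mu> k) (\<lambda>j. embed r H j (b j)) n = truncate r H n b" if "1 \<le> n" "n \<le> k" for n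
    using that
  proof (induction n rule: nat_induct_at_least)
    case base
    then show ?case
      using assms by (auto simp: embed_def truncate_def intro!: restrict_ext)
  next
    case (Suc n)
    then have "left_prod (\<mu> k) (\<lambda>j. embed r H j (b j)) (Suc n)
        = \<mu> k (truncate r H n b) (embed r H (Suc n) (b (Suc n)))"
      by (simp add: left_prod_Suc)
    also have "\<dots> = truncate r H (Suc n) b"
      using Suc.hyps Suc.prems assms(2,3)
      by (subst append) (auto simp: truncate_in_R entry_closed truncate_Suc)
    finally show ?case .
  qed
  moreover have "act k \<one>\<^bsub>H (Suc k)\<^esub> b = left_prod (\<mu> k) (\<lambda>j. embed r H j (b j)) k"
    unfolding act_def using assms
    by (intro left_prod_cong) (auto simp: phi_tuple_one_left entry_closed)
  ultimately show ?thesis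
    using \<open>1 \<le> k\<close> by simp
qed

text \<open>
  For \<open>m + 1 = k\<close> the new entry enters through the group law of \<open>H\<^sub>k\<close>, and the lower entries of
  the embedded element contribute the trivial tuple.  For \<open>m + 1 < k\<close> both arguments are
  trivial at position \<open>k\<close>, so the recursion acts by \<open>1 \<in> H\<^sub>k\<close>, which changes nothing, and the claim descends to \<open>\<mu>\<^sub>k\<^sub>-\<^sub>1\<close>.
\<close>

lemma mu_append:
  assumes "1 \<le> k" "k \<le> r" "m < k" "c \<in> R m" "x \<in> carrier (H (Suc m))"
  shows "\<mu> k c (embed r H (Suc m) x) = put_top m c x"
  using assms
proof (induction k arbitrary: m c x rule: nat_induct_at_least)
  case base
  then have "c 1 = \<one>\<^bsub>H 1\<^esub>"
    by (auto simp: entry_beyond)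
  then show ?case
    using base by (auto simp: embed_def put_top_def entry_beyond intro!: restrict_ext)
next
  case (Suc k)
  have top: "c (Suc k) = \<one>\<^bsub>H (Suc k)\<^esub>"
    using Suc.prems by (auto simp: entry_beyond)
  have tr: "truncate r H k c = c"
    using Suc.prems by (auto intro!: truncate_id R_mono[of c m])
  show ?case
  proof (cases "m = k")
    case True
    have "act k (c (Suc k)) (embed r H (Suc k) x) = trivial"
      using Suc.hyps Suc.prems
      by (intro act_trivial) (auto simp: top one_closed, auto simp: embed_def)
    then have "\<mu> (Suc k) c (embed r H (Suc k) x)
        = put_top k (\<mu> k c trivial) (c (Suc k) \<otimes>\<^bsub>H (Suc k)\<^esub> embed r H (Suc k) x (Suc k))"
      using Suc.hyps Suc.prems by (simp add: mu_Suc tr)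
    also have "c (Suc k) \<otimes>\<^bsub>H (Suc k)\<^esub> embed r H (Suc k) x (Suc k) = x"
      using Suc.prems True unfolding top by (auto simp: embed_def)
    finally show ?thesis
      using Suc True by (simp add: mu_trivial_right)
  next
    case False
    then have m: "m < k"
      using Suc.prems by simp
    have emb: "embed r H (Suc m) x \<in> R k"
      using m Suc.prems by (intro embed_in_R) auto
    have "act k (c (Suc k)) (embed r H (Suc m) x) = embed r H (Suc m) x"
      unfolding top
      using Suc.hyps Suc.prems emb
      by (subst act_one_aux) (auto simp: truncate_id intro!: Suc.IH)
    then have "\<mu> (Suc k) c (embed r H (Suc m) x)
        = put_top k (\<mu> k c (embed r H (Suc m) x))
            (c (Suc k) \<otimes>\<^bsub>H (Suc k)\<^esub> embed r H (Suc m) x (Suc k))"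
      using Suc.hyps Suc.prems by (simp add: mu_Suc tr)
    also have "c (Suc k) \<otimes>\<^bsub>H (Suc k)\<^esub> embed r H (Suc m) x (Suc k) = \<one>\<^bsub>H (Suc k)\<^esub>"
      using Suc.prems emb unfolding top by (simp add: entry_beyond one_closed)
    also have "\<mu> k c (embed r H (Suc m) x) = put_top m c x"
      using m Suc.prems by (intro Suc.IH) auto
    also have "put_top k (put_top m c x) \<one>\<^bsub>H (Suc k)\<^esub> = put_top m c x"
      using m Suc.prems by (intro put_top_one R_mono[OF put_top_in_R]) auto
    finally show ?thesis .
  qed
qed

lemma act_one:
  assumes "1 \<le> k" "Suc k \<le> r" "b \<in> R l"
  shows "act k \<one>\<^bsub>H (Suc k)\<^esub> b = truncate r H k b"
  using assms by (intro act_one_aux mu_append) auto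

text \<open>
  The top entries are trivial, and the action of \<open>1 \<in> H\<^sub>k\<^sub>+\<^sub>1\<close> reassembles the second argument.
\<close>

lemma mu_Suc_restrict:
  assumes "1 \<le> k" "Suc k \<le> r" "a \<in> R k" "b \<in> R k"
  shows "\<mu> (Suc k) a b = \<mu> k a b"
proof -
  have "a (Suc k) = \<one>\<^bsub>H (Suc k)\<^esub>" "b (Suc k) = \<one>\<^bsub>H (Suc k)\<^esub>"
    using assms by (auto simp: entry_beyond)
  then show ?thesis
    using assms by (simp add: mu_Suc act_one truncate_id one_closed put_top_one mu_closed)
qed

lemma mu_restrict:
  assumes "1 \<le> k" "k \<le> l" "l \<le> r" "a \<in> R k" "b \<in> R k"
  shows "\<mu> l a b = \<mu> k a b"
  using assms(2,3)
proof (induction l rule: dec_induct)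
  case (step l)
  have "\<mu> (Suc l) a b = \<mu> l a b"
    using step assms by (intro mu_Suc_restrict R_mono[of _ k l]) auto
  then show ?case
    using step by simp
qed simp

lemma mu_trivial_left:
  assumes "1 \<le> k" "k \<le> r" "c \<in> R k"
  shows "\<mu> k trivial c = c"
  using assms
proof (induction k arbitrary: c rule: nat_induct_at_least)
  case base
  then have "trivial 1 = \<one>\<^bsub>H 1\<^esub>"
    by (simp add: trivial_def)
  then show ?case
    using base
    by (intro R_eqI[of _ 1 _ 1])
      (auto intro!: embed_in_R simp: entry_closed, auto simp: embed_def entry_closed entry_beyond)
next
  case (Suc k)
  have "trivial (Suc k) = \<one>\<^bsub>H (Suc k)\<^esub>"
    using Suc.prems by (simp add: trivial_def)
  then show ?case
    using Suc
    by (simp add: mu_Suc act_one truncate_id trivial_in_R truncate_in_R entry_closed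
        put_top_truncate)
qed

text \<open>
  Only the factor at position \<open>j\<close> is nontrivial; isolating it takes both unit laws.
\<close>

lemma act_embed:
  assumes "1 \<le> j" "j \<le> k" "Suc k \<le> r" "h \<in> carrier (H (Suc k))" "x \<in> carrier (H j)"
  shows "act k h (embed r H j x) = phi_tuple r H \<phi> br (Suc k) j h x"
proof -
  let ?y = "phi_tuple r H \<phi> br (Suc k) j h x"
  have "?y \<in> R k"
    using assms by (intro phi_tuple_in_R) auto
  have "act k h (embed r H j x) = left_prod (\<mu> k) (\<lambda>i. if i = j then ?y else trivial) k"
    unfolding act_def using assms
    by (intro left_prod_cong) (auto simp: embed_def phi_tuple_one_right)
  also have "\<dots> = ?y"
    using assms \<open>?y \<in> R k\<close>
    by (subst left_prod_single) (auto simp: mu_trivial_left mu_trivial_right trivial_in_R)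
  finally show ?thesis .
qed

lemma mu_embed_below:
  assumes "1 \<le> j" "j \<le> k" "Suc k \<le> r" "h \<in> carrier (H (Suc k))" "x \<in> carrier (H j)"
  shows "\<mu> (Suc k) (embed r H (Suc k) h) (embed r H j x)
    = put_top k (phi_tuple r H \<phi> br (Suc k) j h x) h"
proof -
  have "phi_tuple r H \<phi> br (Suc k) j h x \<in> R k"
    using assms by (intro phi_tuple_in_R) auto
  moreover have "truncate r H k (embed r H (Suc k) h) = trivial"
    by (auto simp: truncate_def embed_def trivial_def intro!: restrict_ext)
  moreover have "embed r H (Suc k) h (Suc k) = h" "embed r H j x (Suc k) = \<one>\<^bsub>H (Suc k)\<^esub>"
    using assms by (auto simp: embed_def)
  ultimately show ?thesis
    using assms by (simp add: mu_Suc act_embed mu_trivial_left)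
qed

lemma mu_embed_same:
  assumes "1 \<le> k" "k \<le> r" "h \<in> carrier (H k)" "x \<in> carrier (H k)"
  shows "\<mu> k (embed r H k h) (embed r H k x) = embed r H k (h \<otimes>\<^bsub>H k\<^esub> x)"
proof (cases "k = 1")
  case True
  then show ?thesis
    using assms by (simp add: embed_def)
next
  case False
  then obtain n where k: "k = Suc n" and n: "1 \<le> n"
    using assms(1) by (cases k) auto
  have "act n h (embed r H k x) = trivial"
    using assms k n by (intro act_trivial) (auto simp: embed_def)
  moreover have "truncate r H n (embed r H k h) = trivial"
    by (auto simp: k truncate_def embed_def trivial_def intro!: restrict_ext)
  moreover have "embed r H k h k = h" "embed r H k x k = x"
    using assms by (auto simp: embed_def)
  ultimately show ?thesis
    using assms n unfolding k
    by (simp add: mu_Suc mu_trivial_left trivial_in_R embed_Suc)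
qed

end

section \<open>Maps assembled from maps on the factors\<close>

locale assembled_map = normalized_total_system r H \<phi> br
  for r :: nat
    and H :: "nat \<Rightarrow> ('a, 'm) monoid_scheme"
    and \<phi> :: "nat \<Rightarrow> nat \<Rightarrow> 'a \<Rightarrow> 'a \<Rightarrow> 'a"
    and br :: "nat \<Rightarrow> nat \<Rightarrow> nat \<Rightarrow> 'a \<Rightarrow> 'a \<Rightarrow> 'a" +
  fixes G' :: "'b set"
    and mult' :: "'b \<Rightarrow> 'b \<Rightarrow> 'b"  (infixl "\<bullet>" 70)
    and fs :: "nat \<Rightarrow> 'a \<Rightarrow> 'b"
    and f :: "(nat \<Rightarrow> 'a) \<Rightarrow> 'b"
  assumes semigroup: "semigroup_on G' mult'"
    and fs_funcset: "\<And>i. 1 \<le> i \<Longrightarrow> i \<le> r \<Longrightarrow> fs i \<in> carrier (H i) \<rightarrow> G'"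
    and f_prod: "\<And>h. h \<in> tuples r H \<Longrightarrow> f h = left_prod mult' (\<lambda>i. fs i (h i)) r"
    and f_embed: "\<And>i h. 1 \<le> i \<Longrightarrow> i \<le> r \<Longrightarrow> h \<in> carrier (H i) \<Longrightarrow> f (embed r H i h) = fs i h"
    and f_mult_embed: "\<And>j k a b. 1 \<le> j \<Longrightarrow> j \<le> k \<Longrightarrow> k \<le> r \<Longrightarrow>
           a \<in> carrier (H k) \<Longrightarrow> b \<in> carrier (H j) \<Longrightarrow>
           f (total_mult r H \<phi> br (embed r H k a) (embed r H j b)) =
           f (embed r H k a) \<bullet> f (embed r H j b)"
begin

lemma G'_closed: "x \<in> G' \<Longrightarrow> y \<in> G' \<Longrightarrow> x \<bullet> y \<in> G'"
  and G'_assoc: "x \<in> G' \<Longrightarrow> y \<in> G' \<Longrightarrow> z \<in> G' \<Longrightarrow> x \<bullet> y \<bullet> z = x \<bullet> (y \<bullet> z)"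
  using semigroup by (auto simp: semigroup_on_def)

lemma fs_closed: "1 \<le> i \<Longrightarrow> i \<le> r \<Longrightarrow> x \<in> carrier (H i) \<Longrightarrow> fs i x \<in> G'"
  using fs_funcset by blast

lemma f_mu_embed:
  assumes "1 \<le> j" "j \<le> k" "k \<le> r" "h \<in> carrier (H k)" "x \<in> carrier (H j)"
  shows "f (\<mu> k (embed r H k h) (embed r H j x)) = fs k h \<bullet> fs j x"
  using assms f_mult_embed[OF assms] mu_restrict[of k r "embed r H k h" "embed r H j x"]
  by (simp add: total_mult_def embed_in_R f_embed)

lemma fs_mult:
  assumes "1 \<le> k" "k \<le> r" "h \<in> carrier (H k)" "x \<in> carrier (H k)"
  shows "fs k (h \<otimes>\<^bsub>H k\<^esub> x) = fs k h \<bullet> fs k x"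
  using assms f_mu_embed[of k k h x] by (simp add: mu_embed_same f_embed mult_closed)

text \<open>
  All the maps \<open>f\<^sub>i\<close> have the same value at \<open>1\<close>, because \<open>1 \<in> H\<^sub>i\<close> is the trivial tuple for every \<open>i\<close>.
\<close>

lemma fs_mult_one:
  assumes "1 \<le> k" "k \<le> r" "h \<in> carrier (H k)" "1 \<le> i" "i \<le> r"
  shows "fs k h \<bullet> fs i \<one>\<^bsub>H i\<^esub> = fs k h"
proof -
  have "fs i \<one>\<^bsub>H i\<^esub> = fs k \<one>\<^bsub>H k\<^esub>"
    using assms f_embed[of i "\<one>\<^bsub>H i\<^esub>"] f_embed[of k "\<one>\<^bsub>H k\<^esub>"] by (simp add: embed_one one_closed)
  then show ?thesis
    using assms fs_mult[of k h "\<one>\<^bsub>H k\<^esub>"] by (simp add: one_closed)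
qed

lemma left_prod_in_G':
  "1 \<le> k \<Longrightarrow> k \<le> r \<Longrightarrow> c \<in> R l \<Longrightarrow> left_prod mult' (\<lambda>i. fs i (c i)) k \<in> G'"
  by (rule left_prod_closed) (auto simp: G'_closed fs_closed entry_closed)

lemma left_prod_mult_one:
  assumes "1 \<le> k" "k \<le> r" "c \<in> R l" "1 \<le> i" "i \<le> r"
  shows "left_prod mult' (\<lambda>i. fs i (c i)) k \<bullet> fs i \<one>\<^bsub>H i\<^esub> = left_prod mult' (\<lambda>i. fs i (c i)) k"
proof (cases "k = 1")
  case True
  then show ?thesis
    using assms by (simp add: fs_mult_one entry_closed)
next
  case False
  then obtain n where "k = Suc n" "1 \<le> n"
    using assms(1) by (cases k) auto
  then show ?thesis
    using assms
    by (simp add: left_prod_Suc G'_assoc left_prod_in_G' fs_closed one_closed entry_closed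
        fs_mult_one)
qed

text \<open>
  The remaining \<open>r - k\<close> factors are \<open>f\<^sub>i(1)\<close>, each of which is absorbed by the product to its left.
\<close>

lemma f_on_R:
  assumes "1 \<le> k" "k \<le> r" "c \<in> R k"
  shows "f c = left_prod mult' (\<lambda>i. fs i (c i)) k"
proof -
  have drop: "left_prod mult' (\<lambda>i. fs i (c i)) n = left_prod mult' (\<lambda>i. fs i (c i)) k"
    if "k \<le> n" "n \<le> r" for n
    using that
  proof (induction n rule: dec_induct)
    case (step n)
    then show ?case
      using assms by (simp add: left_prod_Suc entry_beyond left_prod_mult_one)
  qed simp
  have "c \<in> tuples r H"
    using assms by (simp add: R_def)
  then show ?thesis
    using drop[OF \<open>k \<le> r\<close> order_refl] by (simp add: f_prod)
qed

lemma f_closed: "1 \<le> k \<Longrightarrow> k \<le> r \<Longrightarrow> c \<in> R k \<Longrightarrow> f c \<in> G'"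
  by (simp add: f_on_R left_prod_in_G')

lemma f_put_top:
  assumes "1 \<le> k" "Suc k \<le> r" "c \<in> R k" "x \<in> carrier (H (Suc k))"
  shows "f (put_top k c x) = f c \<bullet> fs (Suc k) x"
proof -
  have "left_prod mult' (\<lambda>i. fs i (put_top k c x i)) k = left_prod mult' (\<lambda>i. fs i (c i)) k"
    using assms by (intro left_prod_cong) (auto simp: put_top_def)
  moreover have "put_top k c x (Suc k) = x"
    using assms by (simp add: put_top_def)
  ultimately show ?thesis
    using assms by (simp add: f_on_R[of "Suc k"] f_on_R[of k] put_top_in_R left_prod_Suc)
qed

text \<open>
  Both sides are the value of \<open>f\<close> at \<open>h \<cdot> x\<close>: this is the rule for moving \<open>h\<close> past \<open>x\<close>.
\<close>

lemma fs_commute: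
  assumes "1 \<le> j" "j \<le> k" "Suc k \<le> r" "h \<in> carrier (H (Suc k))" "x \<in> carrier (H j)"
  shows "f (phi_tuple r H \<phi> br (Suc k) j h x) \<bullet> fs (Suc k) h = fs (Suc k) h \<bullet> fs j x"
proof -
  have "phi_tuple r H \<phi> br (Suc k) j h x \<in> R k"
    using assms by (intro phi_tuple_in_R) auto
  then show ?thesis
    using assms f_mu_embed[of j "Suc k" h x] by (simp add: mu_embed_below f_put_top)
qed

lemma f_mu:
  assumes "1 \<le> k" "k \<le> r" "a \<in> R k" "b \<in> R k"
  shows "f (\<mu> k a b) = f a \<bullet> f b"
  using assms
proof (induction k arbitrary: a b rule: nat_induct_at_least)
  case base
  then have "fs 1 (a 1 \<otimes>\<^bsub>H 1\<^esub> b 1) = fs 1 (a 1) \<bullet> fs 1 (b 1)"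
    by (intro fs_mult) (auto simp: entry_closed)
  then show ?case
    using base by (simp add: f_embed f_on_R[of 1] mult_closed entry_closed)
next
  case (Suc k)
  define h x where "h = a (Suc k)" and "x = b (Suc k)"
  define a' b' where "a' = truncate r H k a" and "b' = truncate r H k b"
  let ?w = "\<lambda>j. phi_tuple r H \<phi> br (Suc k) j h (b j)"
  note k = \<open>1 \<le> k\<close> \<open>Suc k \<le> r\<close>
  have h: "h \<in> carrier (H (Suc k))" and x: "x \<in> carrier (H (Suc k))"
    using k Suc.prems by (auto simp: h_def x_def entry_closed)
  have a': "a' \<in> R k" and b': "b' \<in> R k"
    using Suc.prems by (auto simp: a'_def b'_def truncate_in_R)
  have w: "?w i \<in> R k" if "1 \<le> i" "i \<le> k" for i
    using k Suc.prems h that by (intro phi_tuple_factor_in_R) auto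
  have c: "act k h b \<in> R k"
    using k Suc.prems h by (intro act_in_R)
  have fa: "f a = f a' \<bullet> fs (Suc k) h" and fb: "f b = f b' \<bullet> fs (Suc k) x"
    using k Suc.prems h x a' b'
    by (simp_all add: put_top_truncate a'_def b'_def h_def x_def flip: f_put_top)
  have "f (act k h b) = left_prod mult' (\<lambda>i. f (?w i)) k"
    unfolding act_def using k w Suc.IH by (intro left_prod_hom[of k "R k"]) (auto intro: mu_closed)
  moreover have "f b' = left_prod mult' (\<lambda>i. fs i (b i)) k"
    unfolding f_on_R[OF k(1) Suc_leD[OF k(2)] b'] using k
    by (intro left_prod_cong) (auto simp: b'_def truncate_def)
  moreover have "left_prod mult' (\<lambda>i. f (?w i)) k \<bullet> fs (Suc k) h
      = fs (Suc k) h \<bullet> left_prod mult' (\<lambda>i. fs i (b i)) k"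
    using k h Suc.prems w
    by (intro left_prod_commute[OF semigroup])
      (auto simp: fs_closed f_closed[of k] entry_closed fs_commute)
  ultimately have move: "f (act k h b) \<bullet> fs (Suc k) h = fs (Suc k) h \<bullet> f b'"
    by simp
  have mem: "f a' \<in> G'" "f b' \<in> G'" "f (act k h b) \<in> G'" "fs (Suc k) h \<in> G'" "fs (Suc k) x \<in> G'"
    using k a' b' c h x by (auto intro: f_closed fs_closed)
  have "f (\<mu> (Suc k) a b) = f (\<mu> k a' (act k h b)) \<bullet> fs (Suc k) (h \<otimes>\<^bsub>H (Suc k)\<^esub> x)"
    using k a' c h x
    by (simp add: mu_Suc f_put_top mu_closed mult_closed flip: a'_def h_def x_def)
  also have "\<dots> = f a' \<bullet> f (act k h b) \<bullet> (fs (Suc k) h \<bullet> fs (Suc k) x)"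
    using k a' c h x Suc.IH by (simp add: fs_mult)
  also have "\<dots> = f a' \<bullet> (f (act k h b) \<bullet> fs (Suc k) h) \<bullet> fs (Suc k) x"
    using mem by (simp add: G'_assoc G'_closed)
  also have "\<dots> = f a \<bullet> f b"
    unfolding move fa fb using mem by (simp add: G'_assoc G'_closed)
  finally show ?case .
qed

end

theorem theorem7p3:
  fixes r :: nat
    and H :: "nat \<Rightarrow> ('a, 'm) monoid_scheme"
    and \<phi> :: "nat \<Rightarrow> nat \<Rightarrow> 'a \<Rightarrow> 'a \<Rightarrow> 'a"
    and br :: "nat \<Rightarrow> nat \<Rightarrow> nat \<Rightarrow> 'a \<Rightarrow> 'a \<Rightarrow> 'a"
    and G' :: "'b set"
    and mult' :: "'b \<Rightarrow> 'b \<Rightarrow> 'b"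
    and fs :: "nat \<Rightarrow> 'a \<Rightarrow> 'b"
    and f :: "(nat \<Rightarrow> 'a) \<Rightarrow> 'b"
  assumes "r \<ge> 1"
    and "\<And>i. 1 \<le> i \<Longrightarrow> i \<le> r \<Longrightarrow> group (H i)"
    and "total_system r H \<phi> br"
    and "normalized r H \<phi> br"
    and "semigroup_on G' mult'"
    and "\<And>i. 1 \<le> i \<Longrightarrow> i \<le> r \<Longrightarrow> fs i \<in> carrier (H i) \<rightarrow> G'"
    and "\<And>h. h \<in> tuples r H \<Longrightarrow> f h = left_prod mult' (\<lambda>i. fs i (h i)) r"
    and "\<And>i h. 1 \<le> i \<Longrightarrow> i \<le> r \<Longrightarrow> h \<in> carrier (H i) \<Longrightarrow> f (embed r H i h) = fs i h"
    and "\<And>j k a b. 1 \<le> j \<Longrightarrow> j \<le> k \<Longrightarrow> k \<le> r \<Longrightarrow> a \<in> carrier (H k) \<Longrightarrow> b \<in> carrier (H j) \<Longrightarrow>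
           f (total_mult r H \<phi> br (embed r H k a) (embed r H j b)) =
           mult' (f (embed r H k a)) (f (embed r H j b))"
  shows "\<forall>u\<in>tuples r H. \<forall>v\<in>tuples r H.
           f (total_mult r H \<phi> br u v) = mult' (f u) (f v)"
proof -
  interpret assembled_map r H \<phi> br G' mult' fs f
    using assms
    by (intro assembled_map.intro normalized_total_system.intro assembled_map_axioms.intro)
  show ?thesis
    using f_mu[of r] \<open>r \<ge> 1\<close> by (simp add: total_mult_def R_top)
qed

end
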